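(* Assume $N_m^k>0$ for all $m\in\{1,\dots,M\}$, $k\in[K]$, and $\kappa_m>0$ for every $m\in\{1,\dots,M\}$. Let $(W,H)$ be a global minimizer of the regularized objective $$f(W,H)=g(WH)+\frac{\lambda_W}{2}\|W\|_F^2+\frac{\lambda_H}{2}\|H\|_F^2,\qquad \lambda_W,\lambda_H>0.$$ For each $m\in\{1,\dots,M\}$ fix any constant $c_{1,m}>0$ and define $$\gamma_{1,m}:=\frac{1}{1+c_{1,m}}\cdot\frac{m}{K-m},\qquad \Gamma_2:=\frac1N\sum_{m=1}^M N_m c_{2,m},\qquad \rho:=\|W\|_F^2,$$ $$c_{2,m}:=\frac{c_{1,m}m}{c_{1,m}+1}\log(m)+\frac{m c_{1,m}}{1+c_{1,m}}\log\!\left(\frac{c_{1,m}+1}{c_{1,m}}\right)+\frac{m}{c_{1,m}+1}\log\bigl((K-m)(c_{1,m}+1)\bigr),$$ $$A_m:=\sqrt{\frac{1}{\kappa_m}\cdot\frac{m(K-m)}{K}\cdot\Bigg[\frac{2K}{N_m}+\frac{2K^2}{m^2}\max_{S\in\mathcal S_m}\sum_{j=1}^K\frac{\mathbf 1_S(j)}{N_m^j}\Bigg]}.$$ Then $$g(WH)-\Gamma_2\ \ge\ -\frac1N\sum_{m=1}^M N_m\,\gamma_{1,m}\,A_m\,\sqrt{\frac{\lambda_W}{\lambda_H}}\;\rho.$$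
   Context: Let $K,M,d$ be positive integers with $1\le M\le K-1$, and $[K]=\{1,\dots,K\}$. For $1\le m\le M$ let $\mathcal S_m=\{S\subset[K]:|S|=m\}$. For each $S\in\mathcal S_m$ let $r_{m,S}$ be a nonnegative integer (the number of training samples with label set $S$). Put $N_m=\sum_{S\in\mathcal S_m}r_{m,S}$, $N=\sum_{m=1}^M N_m$, $p_{m,S}=r_{m,S}/N_m$ (so $p_m$ is a probability distribution on $\mathcal S_m$), and for $k\in[K]$, $N_m^k=\sum_{S\in\mathcal S_m,\,k\in S}r_{m,S}$. Let $y_S=\mathbf 1_S\in\mathbb R^K$ be the indicator vector of $S$, with entries $\mathbf 1_S(j)$. The variables are $W\in\mathbb R^{K\times d}$ with rows $w_1^\top,\dots,w_K^\top$, and $H$, the collection of feature vectors $h_{m,S,i}\in\mathbb R^d$ ($1\le m\le M$, $S\in\mathcal S_m$, $1\le i\le r_{m,S}$), with $\|H\|_F^2=\sum_{m,S,i}\|h_{m,S,i}\|_2^2$. The pick-all-labels loss is $\mathcal L_{\mathrm{PAL}}(z,y_S)=\sum_{k\in S}-\log\bigl(e^{z_k}/\sum_{j=1}^K e^{z_j}\bigr)$ for $z\in\mathbb R^K$, $S\subset[K]$. The empirical risk is $$g(WH)=\frac1N\sum_{m=1}^M\sum_{S\in\mathcal S_m}\sum_{i=1}^{r_{m,S}}\mathcal L_{\mathrm{PAL}}(Wh_{m,S,i},y_S).$$ Let $\mathbf 1\in\mathbb R^K$ be the all-ones vector, $\Pi=I-\frac1K\mathbf 1\mathbf 1^\top$,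 $G_m=\mathbb E_{S\sim p_m}[y_Sy_S^\top]=\sum_{S\in\mathcal S_m}p_{m,S}\,y_Sy_S^\top$, and let $\kappa_m$ be the smallest eigenvalue of $\Pi G_m\Pi$ restricted to $\mathrm{range}(\Pi)=\{x\in\mathbb R^K:\mathbf 1^\top x=0\}$. *)

theory Defs
  imports "HOL-Analysis.Analysis"
begin

text \<open>
  The label set \<open>[K]\<close> is the universe of a finite type \<open>'k\<close> (so \<open>K = CARD('k)\<close>) and the feature
  space is \<open>real ^ 'd\<close>. A sample count \<open>r m S\<close> or a feature vector \<open>h m S i\<close> is a total function
  of its indices; only the values at \<open>m \<in> {1..M}\<close>, \<open>S \<in> label_sets m\<close>, \<open>i \<in> {1..r m S}\<close> enter the
  quantities below. The Frobenius norm of a matrix \<open>W :: real ^ 'd ^ 'k\<close> is the library's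
  \<open>norm W\<close>, the Euclidean norm of the vector of its row norms.
\<close>

definition label_sets :: "nat \<Rightarrow> 'k::finite set set" where
  "label_sets m = {S. card S = m}"

definition num_samples :: "(nat \<Rightarrow> 'k::finite set \<Rightarrow> nat) \<Rightarrow> nat \<Rightarrow> nat" where
  "num_samples r m = (\<Sum>S\<in>label_sets m. r m S)"

definition total_samples :: "nat \<Rightarrow> (nat \<Rightarrow> 'k::finite set \<Rightarrow> nat) \<Rightarrow> nat" where
  "total_samples M r = (\<Sum>m=1..M. num_samples r m)"

definition num_samples_with :: "(nat \<Rightarrow> 'k::finite set \<Rightarrow> nat) \<Rightarrow> nat \<Rightarrow> 'k \<Rightarrow> nat" where
  "num_samples_with r m k = (\<Sum>S\<in>{S\<in>label_sets m. k \<in> S}. r m S)"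

definition label_prob :: "(nat \<Rightarrow> 'k::finite set \<Rightarrow> nat) \<Rightarrow> nat \<Rightarrow> 'k set \<Rightarrow> real" where
  "label_prob r m S = real (r m S) / real (num_samples r m)"

definition label_vec :: "'k::finite set \<Rightarrow> real ^ 'k" where
  "label_vec S = (\<chi> j. indicator S j)"

definition pal_loss :: "real ^ 'k::finite \<Rightarrow> 'k set \<Rightarrow> real" where
  "pal_loss z S = (\<Sum>k\<in>S. - ln (exp (z $ k) / (\<Sum>j\<in>UNIV. exp (z $ j))))"

definition logits ::
  "real ^ 'd ^ 'k \<Rightarrow> (nat \<Rightarrow> 'k set \<Rightarrow> nat \<Rightarrow> real ^ 'd) \<Rightarrow> nat \<Rightarrow> 'k set \<Rightarrow> nat \<Rightarrow> real ^ 'k::finite" where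
  "logits W h m S i = W *v h m S i"

definition emp_risk ::
  "nat \<Rightarrow> (nat \<Rightarrow> 'k set \<Rightarrow> nat) \<Rightarrow> (nat \<Rightarrow> 'k set \<Rightarrow> nat \<Rightarrow> real ^ 'k::finite) \<Rightarrow> real" where
  "emp_risk M r Z = 1 / real (total_samples M r) *
     (\<Sum>m=1..M. \<Sum>S\<in>label_sets m. \<Sum>i=1..r m S. pal_loss (Z m S i) S)"

definition feature_sqnorm ::
  "nat \<Rightarrow> (nat \<Rightarrow> 'k::finite set \<Rightarrow> nat) \<Rightarrow> (nat \<Rightarrow> 'k set \<Rightarrow> nat \<Rightarrow> real ^ 'd::finite) \<Rightarrow> real" where
  "feature_sqnorm M r h = (\<Sum>m=1..M. \<Sum>S\<in>label_sets m. \<Sum>i=1..r m S. (norm (h m S i))\<^sup>2)"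

definition objective ::
  "nat \<Rightarrow> (nat \<Rightarrow> 'k set \<Rightarrow> nat) \<Rightarrow> real \<Rightarrow> real \<Rightarrow>
   real ^ 'd ^ 'k \<Rightarrow> (nat \<Rightarrow> 'k::finite set \<Rightarrow> nat \<Rightarrow> real ^ 'd::finite) \<Rightarrow> real" where
  "objective M r lamW lamH W h =
     emp_risk M r (logits W h) + lamW / 2 * (norm W)\<^sup>2 + lamH / 2 * feature_sqnorm M r h"

definition outer :: "real ^ 'k \<Rightarrow> real ^ 'k \<Rightarrow> real ^ 'k ^ 'k" where
  "outer x y = (\<chi> i j. x $ i * y $ j)"

definition centering :: "real ^ 'k::finite ^ 'k" where
  "centering = mat 1 - (1 / real CARD('k)) *\<^sub>R outer 1 1"

definition label_gram :: "(nat \<Rightarrow> 'k set \<Rightarrow> nat) \<Rightarrow> nat \<Rightarrow> real ^ 'k::finite ^ 'k" where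
  "label_gram r m = (\<Sum>S\<in>label_sets m. label_prob r m S *\<^sub>R outer (label_vec S) (label_vec S))"

definition eigenvalues_on :: "real ^ 'k ^ 'k \<Rightarrow> (real ^ 'k::finite) set \<Rightarrow> real set" where
  "eigenvalues_on A V = {\<mu>. \<exists>x\<in>V. x \<noteq> 0 \<and> A *v x = \<mu> *\<^sub>R x}"

definition kappa :: "(nat \<Rightarrow> 'k::finite set \<Rightarrow> nat) \<Rightarrow> nat \<Rightarrow> real" where
  "kappa r m = Min (eigenvalues_on (centering ** label_gram r m ** centering)
                      (range (\<lambda>x. (centering :: real ^ 'k ^ 'k) *v x)))"

definition gamma1 :: "nat \<Rightarrow> nat \<Rightarrow> real \<Rightarrow> real" where
  "gamma1 K m c = 1 / (1 + c) * (real m / (real K - real m))"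

definition c2 :: "nat \<Rightarrow> nat \<Rightarrow> real \<Rightarrow> real" where
  "c2 K m c = c * real m / (c + 1) * ln (real m)
     + real m * c / (1 + c) * ln ((c + 1) / c)
     + real m / (c + 1) * ln ((real K - real m) * (c + 1))"

definition Gamma2 :: "nat \<Rightarrow> (nat \<Rightarrow> 'k::finite set \<Rightarrow> nat) \<Rightarrow> (nat \<Rightarrow> real) \<Rightarrow> real" where
  "Gamma2 M r c1 = 1 / real (total_samples M r) *
     (\<Sum>m=1..M. real (num_samples r m) * c2 CARD('k) m (c1 m))"

definition A_const :: "(nat \<Rightarrow> 'k::finite set \<Rightarrow> nat) \<Rightarrow> nat \<Rightarrow> real" where
  "A_const r m = (let K = real CARD('k) in
     sqrt (1 / kappa r m * (real m * (K - real m) / K) *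
       (2 * K / real (num_samples r m)
        + 2 * K\<^sup>2 / (real m)\<^sup>2 *
          Max ((\<lambda>S. \<Sum>j\<in>UNIV. indicator S j / real (num_samples_with r m j)) ` label_sets m))))"

end

theory Submission
  imports Defs
begin

text \<open>
  A tangent bound for log-sum-exp at a two-level probability vector bounds the loss of a sample with
  label set \<open>S\<close> from below by \<open>c2\<close> plus \<open>gamma1\<close> times the inner product of the logits with
  \<open>1 - (K / m) y\<^sub>S\<close>. The latter vector has squared norm \<open>K (K - m) / m\<close>, so Cauchy--Schwarz bounds
  the sum of these inner products by the Frobenius norms of \<open>W\<close> and \<open>H\<close>, and at a minimizer the
  rescaling \<open>(t W, H / t)\<close> bounds the norm of \<open>H\<close> by that of \<open>W\<close>. The constant obtained in this way is
  at most \<open>A_const\<close>: the smallest eigenvalue \<open>kappa\<close> never exceeds \<open>m\<close>, and each \<open>1 / N\<^sub>m\<^sup>j\<close> is at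
  least \<open>1 / N\<^sub>m\<close>.
\<close>

section \<open>Linear lower bounds for the pick-all-labels loss\<close>

text \<open>Gibbs variational inequality: \<open>1 + x \<le> exp x\<close> at
  \<open>x = z j - ln (q j) - ln Z\<close>, averaged with the weights \<open>q\<close>; the
  right-hand sides then average to 1.\<close>

lemma log_sum_exp_ge:
  fixes z q :: "'a::finite \<Rightarrow> real"
  assumes q: "\<And>j. 0 < q j" and q1: "(\<Sum>j\<in>UNIV. q j) = 1"
  shows "(\<Sum>j\<in>UNIV. q j * (z j - ln (q j))) \<le> ln (\<Sum>j\<in>UNIV. exp (z j))"
proof -
  define Z where "Z = (\<Sum>j\<in>UNIV. exp (z j))"
  have Z: "Z > 0"
    unfolding Z_def by (rule sum_pos) auto
  have "(\<Sum>j\<in>UNIV. q j * (1 + (z j - ln (q j) - ln Z))) \<le>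
    (\<Sum>j\<in>UNIV. q j * exp (z j - ln (q j) - ln Z))"
    by (intro sum_mono mult_left_mono exp_ge_add_one_self) (simp add: q less_imp_le)
  also have "\<dots> = (\<Sum>j\<in>UNIV. exp (z j) / Z)"
    using q Z by (intro sum.cong) (simp_all add: exp_diff less_imp_neq[symmetric])
  also have "\<dots> = 1"
    using Z by (simp add: Z_def flip: sum_divide_distrib)
  also have "(\<Sum>j\<in>UNIV. q j * (1 + (z j - ln (q j) - ln Z))) =
    (\<Sum>j\<in>UNIV. q j) * (1 - ln Z) + (\<Sum>j\<in>UNIV. q j * (z j - ln (q j)))"
    by (simp add: sum_distrib_right flip: sum.distrib) (simp add: algebra_simps)
  finally show ?thesis
    by (simp add: q1 Z_def)
qed

lemma pal_loss_eq:
  "pal_loss z S = real (card S) * ln (\<Sum>j\<in>UNIV. exp (z $ j)) - (\<Sum>k\<in>S. z $ k)"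
proof -
  have "(\<Sum>j\<in>UNIV. exp (z $ j)) > 0"
    by (rule sum_pos) auto
  then have "- ln (exp (z $ k) / (\<Sum>j\<in>UNIV. exp (z $ j))) = ln (\<Sum>j\<in>UNIV. exp (z $ j)) - z $ k" for k
    by (simp add: ln_div)
  then show ?thesis
    by (simp add: pal_loss_def sum_subtractf)
qed

text \<open>For nonempty \<open>S\<close> of size m this is the centered label vector times -K/m,
  hence orthogonal to the all-ones vector.\<close>

definition contrast_vec :: "'k::finite set \<Rightarrow> real ^ 'k" where
  "contrast_vec S = 1 - (real CARD('k) / real (card S)) *\<^sub>R label_vec S"

lemma sum_indicator_cases:
  fixes S :: "'k::finite set" and a b :: "'k \<Rightarrow> real"
  shows "(\<Sum>j\<in>UNIV. if j \<in> S then a j else b j) = (\<Sum>j\<in>S. a j) + (\<Sum>j\<in>-S. b j)"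
  by (simp add: sum.If_cases)

lemma inner_label_vec: "label_vec S \<bullet> z = (\<Sum>j\<in>S. z $ j)"
  by (simp add: label_vec_def inner_vec_def indicator_def if_distrib[of "\<lambda>t. t * _"] sum.If_cases)

lemma norm_label_vec_sq: "(norm (label_vec S))\<^sup>2 = real (card S)"
  unfolding power2_norm_eq_inner inner_label_vec by (simp add: label_vec_def)

lemma inner_one_vec: "(1 :: real ^ 'k::finite) \<bullet> z = (\<Sum>j\<in>UNIV. z $ j)"
  by (simp add: inner_vec_def)

lemma inner_contrast_vec:
  fixes z :: "real ^ 'k::finite"
  shows "contrast_vec S \<bullet> z =
    (\<Sum>j\<in>UNIV. z $ j) - real CARD('k) / real (card S) * (\<Sum>j\<in>S. z $ j)"
  by (simp add: contrast_vec_def inner_diff_left inner_label_vec inner_one_vec)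

text \<open>In the inner product of the vector with itself, only one factor is expanded: the entries
  of the other sum to 0 over all labels and to m - K over \<open>S\<close>.\<close>

lemma norm_contrast_vec_sq:
  fixes S :: "'k::finite set"
  assumes "S \<noteq> {}"
  shows "(norm (contrast_vec S))\<^sup>2 =
    real CARD('k) * (real CARD('k) - real (card S)) / real (card S)"
proof -
  have "card S > 0"
    using assms by (simp add: card_gt_0_iff)
  moreover have "(\<Sum>j\<in>UNIV. contrast_vec S $ j) = 0"
  proof -
    have "(\<Sum>j\<in>UNIV. contrast_vec S $ j) = contrast_vec S \<bullet> 1"
      by (simp add: inner_vec_def)
    then show ?thesis
      using assms by (simp add: inner_contrast_vec)
  qed
  moreover have "(\<Sum>j\<in>S. contrast_vec S $ j) = real (card S) - real CARD('k)"
  proof -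
    have "(\<Sum>j\<in>S. contrast_vec S $ j) = (\<Sum>j\<in>S. 1 - real CARD('k) / real (card S))"
      by (intro sum.cong) (simp_all add: contrast_vec_def label_vec_def)
    then show ?thesis
      using assms by (simp add: right_diff_distrib)
  qed
  ultimately show ?thesis
    unfolding power2_norm_eq_inner inner_contrast_vec by (simp only:) (simp add: algebra_simps diff_divide_distrib)
qed

text \<open>\<open>log_sum_exp_ge\<close> is applied to a distribution of mass c/(1+c) spread evenly
  over \<open>S\<close> and mass 1/(1+c) spread evenly over its complement. The constant part of the
  bound is \<open>c2\<close>, the part linear in \<open>z\<close> is the contrast term.\<close>

lemma pal_loss_ge:
  fixes z :: "real ^ 'k::finite" and S :: "'k set"
  assumes S: "card S = m" and m: "1 \<le> m" "m < CARD('k)" and c: "0 < c"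
  shows "gamma1 CARD('k) m c * (contrast_vec S \<bullet> z) + c2 CARD('k) m c \<le> pal_loss z S"
proof -
  define n where "n = real CARD('k) - real m"
  define a where "a = c / ((1 + c) * real m)"
  define b where "b = 1 / ((1 + c) * n)"
  have pos: "real m > 0" "n > 0" "a > 0" "b > 0"
    using m c by (simp_all add: n_def a_def b_def)
  have cardS: "real (card (- S)) = n"
    using S m by (simp add: Compl_eq_Diff_UNIV card_Diff_subset n_def)
  define q where "q j = (if j \<in> S then a else b)" for j
  have am: "a * real m = c / (1 + c)" and bn: "b * n = 1 / (1 + c)"
    using pos by (simp_all add: a_def b_def)
  have "(\<Sum>j\<in>UNIV. q j) = a * real m + b * n"
    by (simp add: q_def sum_indicator_cases S cardS)
  also have "\<dots> = 1"
    using c unfolding am bn by (simp add: field_simps)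
  finally have q1: "(\<Sum>j\<in>UNIV. q j) = 1" .
  define s where "s = (\<Sum>j\<in>S. z $ j)"
  define u where "u = (\<Sum>j\<in>-S. z $ j)"
  have su: "(\<Sum>j\<in>UNIV. z $ j) = s + u"
    using sum_indicator_cases[of S "\<lambda>j. z $ j" "\<lambda>j. z $ j"] by (simp add: s_def u_def)
  have "(\<Sum>j\<in>UNIV. q j * (z $ j - ln (q j))) =
    (\<Sum>j\<in>UNIV. if j \<in> S then a * (z $ j - ln a) else b * (z $ j - ln b))"
    by (intro sum.cong) (simp_all add: q_def)
  also have "\<dots> = a * s - a * real m * ln a + (b * u - b * n * ln b)"
    unfolding sum_indicator_cases
    by (simp add: s_def u_def S cardS sum_subtractf right_diff_distrib sum_distrib_left)
  finally have "a * s - a * real m * ln a + (b * u - b * n * ln b)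
    \<le> ln (\<Sum>j\<in>UNIV. exp (z $ j))"
    using log_sum_exp_ge[of q "\<lambda>j. z $ j"] q1 pos by (simp add: q_def)
  then have "real m * (a * s - a * real m * ln a + (b * u - b * n * ln b)) - s \<le> pal_loss z S"
    using pos unfolding pal_loss_eq S s_def by simp
  \<comment> \<open>This identifies \<open>c2\<close> as m times the Shannon entropy of
    \<open>q\<close>.\<close>
  moreover have "c2 CARD('k) m c = - real m * (a * real m * ln a + b * n * ln b)"
  proof -
    define L1 where "L1 = ln ((c + 1) / c)"
    define L2 where "L2 = ln (n * (c + 1))"
    have "ln a = - (ln (real m) + L1)"
      using c pos by (simp add: a_def L1_def ln_div ln_mult add.commute)
    moreover have "ln b = - L2"
      using c pos by (simp add: b_def L2_def ln_div add.commute mult.commute)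
    ultimately show ?thesis
      unfolding am bn c2_def n_def[symmetric] L1_def[symmetric] L2_def[symmetric]
      by (simp only:) (simp add: algebra_simps add_divide_distrib)
  qed
  \<comment> \<open>Coefficients agree on both blocks: m b equals \<open>gamma1\<close> off
    \<open>S\<close>, and m a - 1 = -1/(1+c) equals \<open>gamma1\<close> times 1 - K/m on
    \<open>S\<close>.\<close>
  moreover have "gamma1 CARD('k) m c * (contrast_vec S \<bullet> z) = real m * (a * s + b * u) - s"
  proof -
    have K: "real CARD('k) = n + real m"
      by (simp add: n_def)
    have "1 + c > 0"
      using c by simp
    then show ?thesis
      using pos
      unfolding inner_contrast_vec su s_def[symmetric] S gamma1_def K a_def b_def
      by (simp add: divide_simps) (simp add: algebra_simps)
  qed
  ultimately show ?thesis
    by (simp add: algebra_simps)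
qed

section \<open>Norm balance at a global minimizer\<close>

lemma feature_sqnorm_le_minimizer:
  fixes W :: "real ^ 'd::finite ^ 'k::finite"
  assumes lamH: "0 < lamH"
    and opt: "\<forall>(W' :: real ^ 'd ^ 'k) h'. objective M r lamW lamH W h \<le> objective M r lamW lamH W' h'"
  shows "lamH * feature_sqnorm M r h \<le> lamW * (norm W)\<^sup>2"
proof -
  define a where "a = lamW * (norm W)\<^sup>2"
  define b where "b = lamH * feature_sqnorm M r h"
  have le: "b \<le> t\<^sup>2 * a" if t: "t > 1" for t
  proof -
    define h' where "h' m S i = (1 / t) *\<^sub>R h m S i" for m S i
    have "logits (t *\<^sub>R W) h' = logits W h"
      using t by (auto simp: logits_def h'_def fun_eq_iff matrix_vector_mult_scaleR
          scaleR_matrix_vector_assoc[symmetric])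
    moreover have "feature_sqnorm M r h' = feature_sqnorm M r h / t\<^sup>2"
      by (simp add: feature_sqnorm_def h'_def power_divide sum_divide_distrib)
    moreover have "objective M r lamW lamH W h \<le> objective M r lamW lamH (t *\<^sub>R W) h'"
      using opt by blast
    ultimately have "a / 2 + b / 2 \<le> t\<^sup>2 * a / 2 + b / t\<^sup>2 / 2"
      by (simp add: objective_def a_def b_def power_mult_distrib mult_ac)
    then have "(t\<^sup>2 - 1) * b \<le> (t\<^sup>2 - 1) * (t\<^sup>2 * a)"
      using t by (simp add: field_simps)
    then show ?thesis
      using t by (simp add: mult_le_cancel_left one_less_power)
  qed
  \<comment> \<open>The comparison is trivial at t = 1 itself, so the balance is obtained as the
    limit from the right.\<close>
  have "\<forall>\<^sub>F t in at_right 1. b \<le> t\<^sup>2 * a"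
    by (rule eventually_mono[OF eventually_at_right_less]) (rule le)
  moreover have "((\<lambda>t::real. t\<^sup>2 * a) \<longlongrightarrow> 1\<^sup>2 * a) (at_right 1)"
    by (intro tendsto_intros)
  ultimately have "b \<le> 1\<^sup>2 * a"
    by (intro tendsto_lowerbound[of _ _ "at_right 1"]) auto
  then show ?thesis
    by (simp add: a_def b_def)
qed

section \<open>Eigenvalues of self-adjoint matrices on invariant subspaces\<close>

text \<open>Eigenvectors of distinct eigenvalues are orthogonal, hence independent, hence finite in
  number. Together with nonemptiness this makes the \<open>Min\<close> in \<open>kappa\<close> an
  actual eigenvalue.\<close>

lemma finite_eigenvalues_on:
  fixes A :: "real ^ 'k::finite ^ 'k"
  assumes sym: "\<And>x y. x \<bullet> (A *v y) = (A *v x) \<bullet> y"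
  shows "finite (eigenvalues_on A V)"
proof -
  define E where "E = eigenvalues_on A V"
  have "\<forall>\<mu>\<in>E. \<exists>x. x \<noteq> 0 \<and> A *v x = \<mu> *\<^sub>R x"
    by (auto simp: E_def eigenvalues_on_def)
  then obtain v where v: "\<And>\<mu>. \<mu> \<in> E \<Longrightarrow> v \<mu> \<noteq> 0 \<and> A *v v \<mu> = \<mu> *\<^sub>R v \<mu>"
    by metis
  have orth: "v \<mu> \<bullet> v \<nu> = 0" if "\<mu> \<in> E" "\<nu> \<in> E" "\<mu> \<noteq> \<nu>" for \<mu> \<nu>
    using sym[of "v \<mu>" "v \<nu>"] v that by simp
  have inj: "inj_on v E"
    using orth v by (metis inj_onI inner_eq_zero_iff)
  have "pairwise orthogonal (v ` E)"
    using orth by (auto simp: pairwise_def orthogonal_def)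
  then have "independent (v ` E)"
    using v by (intro pairwise_orthogonal_independent) auto
  then have "finite (v ` E)"
    by (rule independent_imp_finite)
  then show ?thesis
    using inj finite_imageD E_def by blast
qed

text \<open>A minimizer of the Rayleigh quotient on the unit sphere of \<open>V\<close> is an
  eigenvector: otherwise a small move along the residual \<open>A *v x - \<mu> *\<^sub>R x\<close>
  would go below the minimum.\<close>

lemma eigenvalues_on_nonempty:
  fixes A :: "real ^ 'k::finite ^ 'k"
  assumes sym: "\<And>x y. x \<bullet> (A *v y) = (A *v x) \<bullet> y"
    and V: "subspace V" and inv: "\<And>x. x \<in> V \<Longrightarrow> A *v x \<in> V" and ne: "v \<in> V" "v \<noteq> 0"
  shows "eigenvalues_on A V \<noteq> {}"
proof -
  define B where "B = sphere 0 1 \<inter> V"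
  have "compact B"
    unfolding B_def by (intro compact_Int_closed closed_subspace V) simp
  moreover have "(1 / norm v) *\<^sub>R v \<in> B"
    using ne V by (auto simp: B_def subspace_scale)
  moreover have "continuous_on B (\<lambda>x. x \<bullet> (A *v x))"
    by (intro continuous_intros linear_continuous_on linear_linear[THEN iffD2]
        matrix_vector_mul_linear)
  ultimately obtain x where x: "x \<in> B" and min: "\<And>y. y \<in> B \<Longrightarrow> x \<bullet> (A *v x) \<le> y \<bullet> (A *v y)"
    using continuous_attains_inf[of B "\<lambda>x. x \<bullet> (A *v x)"] by blast
  define \<mu> where "\<mu> = x \<bullet> (A *v x)"
  \<comment> \<open>By homogeneity, minimality on the sphere says that \<open>q\<close> is
    nonnegative on all of \<open>V\<close>; it vanishes at \<open>x\<close>.\<close>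
  define q where "q y = y \<bullet> (A *v y) - \<mu> * (y \<bullet> y)" for y
  have q: "q y \<ge> 0" if y: "y \<in> V" for y
  proof (cases "y = 0")
    case False
    have "(1 / norm y) *\<^sub>R y \<in> B"
      using False y V by (auto simp: B_def subspace_scale)
    from min[OF this] have "\<mu> \<le> y \<bullet> (A *v y) / (norm y)\<^sup>2"
      by (simp add: \<mu>_def matrix_vector_mult_scaleR power2_eq_square)
    then show ?thesis
      using False by (simp add: q_def power2_norm_eq_inner[symmetric] pos_le_divide_eq)
  qed (simp add: q_def)
  have xV: "x \<in> V" and xx: "x \<bullet> x = 1"
    using x by (auto simp: B_def norm_eq_1)
  define w where "w = A *v x - \<mu> *\<^sub>R x"
  have wV: "w \<in> V"
    unfolding w_def using xV V inv by (intro subspace_diff subspace_scale) auto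
  have expand: "q (x + t *\<^sub>R w) = 2 * t * (w \<bullet> w) + t\<^sup>2 * q w" for t
  proof -
    have 1: "x \<bullet> (A *v w) = w \<bullet> (A *v x)"
      using sym[of x w] by (simp add: inner_commute)
    have 2: "w \<bullet> w = w \<bullet> (A *v x) - \<mu> * (w \<bullet> x)"
      by (subst (2) w_def) (simp add: inner_diff_right)
    have "q (x + t *\<^sub>R w) = x \<bullet> (A *v x) - \<mu> * (x \<bullet> x) + 2 * t * (w \<bullet> (A *v x) - \<mu> * (w \<bullet> x)) + t\<^sup>2 * q w"
      unfolding q_def using 1
      by (simp add: matrix_vector_right_distrib matrix_vector_mult_scaleR inner_add_left
          inner_add_right inner_commute[of x w] power2_eq_square algebra_simps)
    then show ?thesis
      using 2 xx by (simp add: \<mu>_def)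
  qed
  have "w \<bullet> w = 0"
  proof (rule ccontr)
    assume "w \<bullet> w \<noteq> 0"
    then have ww: "w \<bullet> w > 0"
      by (metis inner_ge_zero less_le)
    \<comment> \<open>The added 1 keeps the divisor positive even if \<open>q w\<close> is 0; the
      \<open>t\<close> chosen below minimizes
      \<open>2 * t * (w \<bullet> w) + t\<^sup>2 * p\<close>.\<close>
    define p where "p = q w + 1"
    have p: "p > 0" and qp: "q w < p"
      using q[OF wV] by (simp_all add: p_def)
    define t where "t = - (w \<bullet> w) / p"
    have "0 \<le> q (x + t *\<^sub>R w)"
      using xV wV V by (intro q subspace_add subspace_scale)
    also have "\<dots> = 2 * t * (w \<bullet> w) + t\<^sup>2 * q w"
      by (rule expand)
    also have "\<dots> \<le> 2 * t * (w \<bullet> w) + t\<^sup>2 * p"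
      using qp by (intro add_left_mono mult_left_mono) auto
    also have "\<dots> = - ((w \<bullet> w)\<^sup>2 / p)"
      using p by (simp add: t_def power2_eq_square)
    also have "\<dots> < 0"
      using ww p by simp
    finally show False
      by simp
  qed
  then have "A *v x = \<mu> *\<^sub>R x"
    by (simp add: w_def)
  moreover have "x \<noteq> 0"
    using xx by auto
  ultimately show ?thesis
    using xV by (auto simp: eigenvalues_on_def)
qed

section \<open>The centered label Gram matrix and an upper bound for its smallest eigenvalue\<close>

lemma outer_mult_vec: "outer x y *v z = (y \<bullet> z) *\<^sub>R x"
  by (simp add: outer_def matrix_vector_mult_def vec_eq_iff inner_vec_def sum_distrib_left
      sum_distrib_right mult_ac)

lemma scaleR_mult_vec: "(c *\<^sub>R (A :: real ^ 'n ^ 'm::finite)) *v x = c *\<^sub>R (A *v x)"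
  by (simp add: scaleR_matrix_vector_assoc)

lemma centering_mult_vec:
  "(centering :: real ^ 'k::finite ^ 'k) *v x = x - ((1 \<bullet> x) / real CARD('k)) *\<^sub>R 1"
  by (simp add: centering_def matrix_vector_mult_diff_rdistrib scaleR_mult_vec outer_mult_vec)

lemma centering_self_adjoint:
  "x \<bullet> ((centering :: real ^ 'k::finite ^ 'k) *v y) = (centering *v x) \<bullet> y"
  by (simp add: centering_mult_vec inner_diff_left inner_diff_right inner_commute)

lemma centering_idempotent:
  "(centering :: real ^ 'k::finite ^ 'k) *v (centering *v x) = centering *v x"
proof -
  have "(1 :: real ^ 'k) \<bullet> 1 = real CARD('k)"
    by (simp add: inner_one_vec)
  then show ?thesis
    by (simp add: centering_mult_vec inner_diff_right)
qed

lemma label_gram_mult_vec: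
  "label_gram r m *v x = (\<Sum>S\<in>label_sets m. (label_prob r m S * (label_vec S \<bullet> x)) *\<^sub>R label_vec S)"
  unfolding label_gram_def
  by (induction rule: infinite_finite_induct[of _ "label_sets m"])
    (simp_all add: matrix_vector_mult_add_rdistrib scaleR_mult_vec outer_mult_vec)

lemma inner_label_gram:
  "x \<bullet> (label_gram r m *v y) =
    (\<Sum>S\<in>label_sets m. label_prob r m S * (label_vec S \<bullet> x) * (label_vec S \<bullet> y))"
  by (simp add: label_gram_mult_vec inner_sum_right inner_commute mult_ac)

lemma label_prob_nonneg: "0 \<le> label_prob r m S"
  by (simp add: label_prob_def)

text \<open>Stated as an inequality because without samples of size m all quotients are
  \<open>0 / 0 = 0\<close>.\<close>

lemma sum_label_prob_le_1: "(\<Sum>S\<in>label_sets m. label_prob r m S) \<le> 1"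
proof -
  have "(\<Sum>S\<in>label_sets m. label_prob r m S) = real (num_samples r m) / real (num_samples r m)"
    by (simp add: label_prob_def num_samples_def flip: sum_divide_distrib)
  then show ?thesis
    by simp
qed

text \<open>The form is a weighted sum of squares \<open>(label_vec S \<bullet> x)\<^sup>2\<close>,
  each controlled by Cauchy-Schwarz since a label vector of size m has squared norm m.\<close>

lemma label_gram_form_le: "x \<bullet> (label_gram r m *v x) \<le> real m * (x \<bullet> x)"
proof -
  have "x \<bullet> (label_gram r m *v x) = (\<Sum>S\<in>label_sets m. label_prob r m S * (label_vec S \<bullet> x)\<^sup>2)"
    by (simp add: inner_label_gram power2_eq_square mult.assoc)
  also have "\<dots> \<le> (\<Sum>S\<in>label_sets m. label_prob r m S * (real m * (x \<bullet> x)))"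
  proof (intro sum_mono mult_left_mono label_prob_nonneg)
    fix S :: "'a set"
    assume "S \<in> label_sets m"
    then have "label_vec S \<bullet> label_vec S = real m"
      using norm_label_vec_sq[of S] by (simp add: power2_norm_eq_inner label_sets_def)
    then show "(label_vec S \<bullet> x)\<^sup>2 \<le> real m * (x \<bullet> x)"
      using Cauchy_Schwarz_ineq[of "label_vec S" x] by simp
  qed
  also have "\<dots> = (\<Sum>S\<in>label_sets m. label_prob r m S) * (real m * (x \<bullet> x))"
    by (simp add: sum_distrib_right)
  also have "\<dots> \<le> 1 * (real m * (x \<bullet> x))"
    by (intro mult_right_mono sum_label_prob_le_1) simp
  finally show ?thesis
    by simp
qed

text \<open>An eigenvector \<open>x\<close> for \<open>kappa\<close> is fixed by the centering
  projection, so its Rayleigh quotient is that of the label Gram matrix alone. Two labels are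
  required for the range of the projection to contain a nonzero vector.\<close>

lemma kappa_le:
  fixes r :: "nat \<Rightarrow> 'k::finite set \<Rightarrow> nat"
  assumes "CARD('k) \<ge> 2"
  shows "kappa r m \<le> real m"
proof -
  let ?P = "centering :: real ^ 'k ^ 'k"
  define A where "A = ?P ** label_gram r m ** ?P"
  define V where "V = range (\<lambda>x. ?P *v x)"
  have A: "A *v x = ?P *v (label_gram r m *v (?P *v x))" for x
    by (simp add: A_def matrix_vector_mul_assoc[symmetric])
  have sym: "x \<bullet> (A *v y) = (A *v x) \<bullet> y" for x y
  proof -
    have "x \<bullet> (A *v y) = (?P *v x) \<bullet> (label_gram r m *v (?P *v y))"
      by (simp only: A centering_self_adjoint)
    also have "\<dots> = (?P *v y) \<bullet> (label_gram r m *v (?P *v x))"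
      by (simp add: inner_label_gram mult_ac)
    also have "\<dots> = y \<bullet> (A *v x)"
      by (simp only: A centering_self_adjoint)
    finally show ?thesis
      by (simp add: inner_commute)
  qed
  have V: "subspace V"
    unfolding V_def by (intro linear_subspace_image matrix_vector_mul_linear subspace_UNIV)
  obtain k l :: 'k where "k \<noteq> l"
    using assms by (metis UNIV_I card_le_Suc0_iff_eq finite not_less_eq_eq numeral_2_eq_2)
  \<comment> \<open>Centering shifts all coordinates equally, so the difference between coordinates
    \<open>k\<close> and \<open>l\<close> survives and \<open>v\<close> is nonzero.\<close>
  define v where "v = ?P *v axis k 1"
  have "v $ k - v $ l = 1"
    using \<open>k \<noteq> l\<close> by (simp add: v_def centering_mult_vec axis_def)
  then have "v \<noteq> 0"
    by auto
  moreover have "v \<in> V"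
    by (simp add: v_def V_def)
  ultimately have "eigenvalues_on A V \<noteq> {}"
    by (intro eigenvalues_on_nonempty[where v = v] sym V) (auto simp: A V_def)
  moreover have "kappa r m = Min (eigenvalues_on A V)"
    by (simp add: kappa_def A_def V_def)
  ultimately have "kappa r m \<in> eigenvalues_on A V"
    using finite_eigenvalues_on[OF sym] by simp
  then obtain x where x: "x \<in> V" "x \<noteq> 0" "A *v x = kappa r m *\<^sub>R x"
    by (auto simp: eigenvalues_on_def)
  have Px: "?P *v x = x"
    using x(1) by (auto simp: V_def centering_idempotent)
  have "kappa r m * (x \<bullet> x) = x \<bullet> (A *v x)"
    by (simp add: x(3))
  also have "\<dots> = x \<bullet> (label_gram r m *v x)"
    by (simp only: A centering_self_adjoint Px)
  also have "\<dots> \<le> real m * (x \<bullet> x)"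
    by (rule label_gram_form_le)
  finally show ?thesis
    using x(2) by simp
qed

section \<open>Comparison with the constant \<open>A_const\<close>\<close>

lemma num_samples_with_le: "num_samples_with r m k \<le> num_samples r m"
  unfolding num_samples_with_def num_samples_def by (rule sum_mono2) auto

text \<open>The left side is the constant that the Cauchy-Schwarz argument yields. Under the root of
  \<open>A_const\<close>, 1/\<open>kappa\<close> is at least 1/m and the maximum is at least m/N_m;
  the summand 2K/N_m and one factor 2 are slack.\<close>

lemma A_const_ge:
  fixes r :: "nat \<Rightarrow> 'k::finite set \<Rightarrow> nat"
  assumes m: "1 \<le> m" "m < CARD('k)" and pos: "\<And>k. num_samples_with r m k > 0" and kap: "kappa r m > 0"
  shows "sqrt (real CARD('k) * (real CARD('k) - real m) / real m / real (num_samples r m)) \<le> A_const r m"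
proof -
  define K where "K = real CARD('k)"
  define n where "n = real (num_samples r m)"
  define X where "X = Max ((\<lambda>S. \<Sum>j\<in>UNIV. indicator S j / real (num_samples_with r m j)) `
    (label_sets m :: 'k set set))"
  \<comment> \<open>\<open>undefined\<close> serves as an arbitrary label; its positive count bounds
    \<open>n\<close> from below.\<close>
  have n: "n > 0"
    using pos num_samples_with_le[of r m undefined] unfolding n_def
    by (metis gr0I le_zero_eq less_irrefl of_nat_0_less_iff)
  have K: "K > real m" "real m > 0" and k: "kappa r m \<le> real m"
    using m kappa_le[of r m] by (auto simp: K_def)
  obtain S :: "'k set" where S: "card S = m"
    using m obtain_subset_with_card_n[of m "UNIV :: 'k set"] by auto
  have "real m / n = (\<Sum>j\<in>S. 1 / n)"
    by (simp add: S)
  also have "\<dots> \<le> (\<Sum>j\<in>S. 1 / real (num_samples_with r m j))"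
    using pos num_samples_with_le[of r m] n
    by (intro sum_mono divide_left_mono) (auto simp: n_def)
  also have "\<dots> = (\<Sum>j\<in>UNIV. indicator S j / real (num_samples_with r m j))"
    by (intro sum.mono_neutral_cong_left) auto
  also have "\<dots> \<le> X"
    unfolding X_def using S by (intro Max_ge) (auto simp: label_sets_def)
  finally have X: "real m / n \<le> X" .
  \<comment> \<open>Factored to match the product under the root of \<open>A_const\<close>, so that
    the factors can be compared one by one.\<close>
  have "K * (K - m) / m / n = (1 / m) * (m * (K - m) / K) * (K\<^sup>2 / (real m)\<^sup>2 * (m / n))"
    using K n by (simp add: field_simps power2_eq_square)
  also have "\<dots> \<le> (1 / kappa r m) * (m * (K - m) / K) * (2 * K / n + 2 * K\<^sup>2 / (real m)\<^sup>2 * X)"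
  proof (intro mult_mono)
    show "1 / real m \<le> 1 / kappa r m"
      using k kap by (simp add: frac_le)
    have "0 \<le> K\<^sup>2 / (real m)\<^sup>2 * (m / n)" and "0 \<le> 2 * K / n"
      using K n by simp_all
    moreover have "K\<^sup>2 / (real m)\<^sup>2 * (m / n) \<le> K\<^sup>2 / (real m)\<^sup>2 * X"
      using X by (intro mult_left_mono) auto
    ultimately show "K\<^sup>2 / (real m)\<^sup>2 * (m / n) \<le> 2 * K / n + 2 * K\<^sup>2 / (real m)\<^sup>2 * X"
      by simp
  qed (use K n kap in auto)
  finally show ?thesis
    unfolding A_const_def Let_def K_def n_def X_def by (rule real_sqrt_le_mono)
qed

section \<open>Summation over the samples\<close>

text \<open>Cauchy-Schwarz in each row; \<open>norm A\<close> is the Frobenius norm.\<close>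

lemma norm_matrix_vector_mult_le:
  fixes A :: "real ^ 'n::finite ^ 'm::finite"
  shows "norm (A *v x) \<le> norm A * norm x"
proof -
  have "(norm (A *v x))\<^sup>2 = (\<Sum>i\<in>UNIV. (A $ i \<bullet> x)\<^sup>2)"
    by (simp add: norm_vec_def L2_set_def sum_nonneg matrix_vector_mul_component)
  also have "\<dots> \<le> (\<Sum>i\<in>UNIV. (norm (A $ i))\<^sup>2 * (norm x)\<^sup>2)"
    using Cauchy_Schwarz_ineq by (intro sum_mono) (simp add: power2_norm_eq_inner)
  also have "\<dots> = (norm A * norm x)\<^sup>2"
    by (simp add: norm_vec_def L2_set_def sum_nonneg power_mult_distrib sum_distrib_right)
  finally show ?thesis
    by (rule power2_le_imp_le) simp
qed

text \<open>Cauchy-Schwarz against the constant 1 over the sample indices of size m, followed by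
  enlarging the sum of squares to all sizes.\<close>

lemma sum_norm_features_le:
  fixes r :: "nat \<Rightarrow> 'k::finite set \<Rightarrow> nat" and h :: "nat \<Rightarrow> 'k set \<Rightarrow> nat \<Rightarrow> real ^ 'd::finite"
  assumes "m \<in> {1..M}"
  shows "(\<Sum>S\<in>label_sets m. \<Sum>i=1..r m S. norm (h m S i)) \<le>
    sqrt (real (num_samples r m) * feature_sqnorm M r h)"
proof -
  define I where "I = Sigma (label_sets m :: 'k set set) (\<lambda>S. {1..r m S})"
  have card: "real (card I) = real (num_samples r m)"
    by (simp add: I_def num_samples_def)
  have "((\<Sum>S\<in>label_sets m. \<Sum>i=1..r m S. norm (h m S i)))\<^sup>2 = (\<Sum>(S, i)\<in>I. norm (h m S i) * 1)\<^sup>2"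
    by (simp add: I_def sum.Sigma)
  also have "\<dots> \<le> (\<Sum>(S, i)\<in>I. (norm (h m S i))\<^sup>2) * (\<Sum>_\<in>I. 1\<^sup>2)"
    using Cauchy_Schwarz_ineq_sum[of "\<lambda>(S, i). norm (h m S i)" "\<lambda>_. 1" I]
    by (simp add: case_prod_unfold)
  also have "\<dots> = real (num_samples r m) * (\<Sum>S\<in>label_sets m. \<Sum>i=1..r m S. (norm (h m S i))\<^sup>2)"
    using card by (simp add: I_def sum.Sigma mult.commute)
  also have "\<dots> \<le> real (num_samples r m) * feature_sqnorm M r h"
    unfolding feature_sqnorm_def using assms
    by (intro mult_left_mono member_le_sum sum_nonneg) auto
  finally show ?thesis
    by (rule real_le_rsqrt)
qed

text \<open>The contribution of a single label-set size m; \<open>t\<close> is a bound on the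
  squared feature norm relative to that of \<open>W\<close>, later taken to be
  \<open>lamW / lamH\<close>.\<close>

lemma sum_pal_loss_ge:
  fixes r :: "nat \<Rightarrow> 'k::finite set \<Rightarrow> nat" and h :: "nat \<Rightarrow> 'k set \<Rightarrow> nat \<Rightarrow> real ^ 'd::finite"
  assumes mM: "m \<in> {1..M}" and mK: "m < CARD('k)"
    and pos: "\<And>k. num_samples_with r m k > 0" and kap: "kappa r m > 0" and c: "0 < c"
    and t: "0 \<le> t" and bal: "feature_sqnorm M r h \<le> t * (norm W)\<^sup>2"
  shows "real (num_samples r m) * c2 CARD('k) m c
      - real (num_samples r m) * gamma1 CARD('k) m c * A_const r m * sqrt t * (norm W)\<^sup>2
    \<le> (\<Sum>S\<in>label_sets m. \<Sum>i=1..r m S. pal_loss (logits W h m S i) S)"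
proof -
  define n where "n = real (num_samples r m)"
  define \<gamma> where "\<gamma> = gamma1 CARD('k) m c"
  define B where "B = real CARD('k) * (real CARD('k) - real m) / real m"
  have m: "1 \<le> m"
    using mM by simp
  have \<gamma>: "\<gamma> \<ge> 0" and B: "B \<ge> 0"
    using c mK by (auto simp: \<gamma>_def gamma1_def B_def)
  have n: "n > 0"
    using pos num_samples_with_le[of r m undefined] unfolding n_def
    by (metis gr0I le_zero_eq less_irrefl of_nat_0_less_iff)
  have sample: "c2 CARD('k) m c - \<gamma> * (sqrt B * norm W * norm (h m S i)) \<le>
      pal_loss (logits W h m S i) S" if "S \<in> label_sets m" for S i
  proof -
    have S: "card S = m"
      using that by (simp add: label_sets_def)
    then have "S \<noteq> {}"
      using m by auto
    then have "norm (contrast_vec S) = sqrt B"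
      using norm_contrast_vec_sq[of S] S by (simp add: B_def real_sqrt_unique)
    then have "\<bar>contrast_vec S \<bullet> logits W h m S i\<bar> \<le> sqrt B * norm (W *v h m S i)"
      using Cauchy_Schwarz_ineq2[of "contrast_vec S"] by (simp add: logits_def)
    also have "\<dots> \<le> sqrt B * (norm W * norm (h m S i))"
      using B by (intro mult_left_mono norm_matrix_vector_mult_le) simp
    finally have "\<gamma> * - (sqrt B * norm W * norm (h m S i)) \<le> \<gamma> * (contrast_vec S \<bullet> logits W h m S i)"
      using \<gamma> by (intro mult_left_mono) auto
    then show ?thesis
      using pal_loss_ge[OF S m mK c, of "logits W h m S i"] by (simp add: \<gamma>_def)
  qed
  have feat: "(\<Sum>S\<in>label_sets m. \<Sum>i=1..r m S. norm (h m S i)) \<le> sqrt n * sqrt t * norm W"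
  proof -
    have "sqrt (n * feature_sqnorm M r h) \<le> sqrt (n * (t * (norm W)\<^sup>2))"
      using bal n by simp
    then show ?thesis
      using sum_norm_features_le[OF mM, where r = r and h = h] by (simp add: n_def real_sqrt_mult)
  qed
  have "sqrt B * norm W * (\<Sum>S\<in>label_sets m. \<Sum>i=1..r m S. norm (h m S i))
    \<le> sqrt B * norm W * (sqrt n * sqrt t * norm W)"
    using B by (intro mult_left_mono feat) auto
  \<comment> \<open>Rewriting \<open>sqrt B * sqrt n\<close> as \<open>n * sqrt (B / n)\<close>
    exposes the quantity bounded by \<open>A_const_ge\<close>.\<close>
  also have "\<dots> = n * sqrt (B / n) * (sqrt t * (norm W)\<^sup>2)"
    using n by (simp add: real_sqrt_divide power2_eq_square real_div_sqrt field_simps)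
  also have "\<dots> \<le> n * A_const r m * (sqrt t * (norm W)\<^sup>2)"
    using A_const_ge[OF m mK pos kap] n t
    by (intro mult_right_mono mult_left_mono) (auto simp: B_def n_def)
  finally have "\<gamma> * (sqrt B * norm W * (\<Sum>S\<in>label_sets m. \<Sum>i=1..r m S. norm (h m S i)))
    \<le> \<gamma> * (n * A_const r m * (sqrt t * (norm W)\<^sup>2))"
    using \<gamma> by (intro mult_left_mono)
  then have "n * c2 CARD('k) m c - n * \<gamma> * A_const r m * sqrt t * (norm W)\<^sup>2 \<le>
    n * c2 CARD('k) m c - \<gamma> * (sqrt B * norm W * (\<Sum>S\<in>label_sets m. \<Sum>i=1..r m S. norm (h m S i)))"
    by (simp add: mult_ac)
  also have "\<dots> = (\<Sum>S\<in>label_sets m. \<Sum>i=1..r m S.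
      c2 CARD('k) m c - \<gamma> * (sqrt B * norm W * norm (h m S i)))"
    by (simp add: n_def num_samples_def sum_subtractf sum_distrib_left sum_distrib_right)
  also have "\<dots> \<le> (\<Sum>S\<in>label_sets m. \<Sum>i=1..r m S. pal_loss (logits W h m S i) S)"
    by (intro sum_mono sample)
  finally show ?thesis
    by (simp add: n_def \<gamma>_def)
qed

section \<open>Assembly over all label-set sizes\<close>

theorem theorem4p1:
  fixes M :: nat
    and r :: "nat \<Rightarrow> 'k::finite set \<Rightarrow> nat"
    and W :: "real ^ 'd::finite ^ 'k"
    and h :: "nat \<Rightarrow> 'k set \<Rightarrow> nat \<Rightarrow> real ^ 'd"
    and lamW lamH :: real
    and c1 :: "nat \<Rightarrow> real"
  assumes "1 \<le> M" and "M \<le> CARD('k) - 1"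
    and "\<forall>m\<in>{1..M}. \<forall>k. num_samples_with r m k > 0"
    and "\<forall>m\<in>{1..M}. kappa r m > 0"
    and "lamW > 0" and "lamH > 0"
    and "\<forall>(W' :: real ^ 'd ^ 'k) h'. objective M r lamW lamH W h \<le> objective M r lamW lamH W' h'"
    and "\<forall>m\<in>{1..M}. c1 m > 0"
  shows "emp_risk M r (logits W h) - Gamma2 M r c1 \<ge>
    - (1 / real (total_samples M r) *
        (\<Sum>m=1..M. real (num_samples r m) * gamma1 CARD('k) m (c1 m) * A_const r m *
           sqrt (lamW / lamH) * (norm W)\<^sup>2))"
proof -
  have bal: "feature_sqnorm M r h \<le> lamW / lamH * (norm W)\<^sup>2"
    using feature_sqnorm_le_minimizer[OF assms(6,7)] assms(6) by (simp add: field_simps)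
  have "(\<Sum>m=1..M. real (num_samples r m) * c2 CARD('k) m (c1 m)
      - real (num_samples r m) * gamma1 CARD('k) m (c1 m) * A_const r m * sqrt (lamW / lamH) * (norm W)\<^sup>2)
    \<le> (\<Sum>m=1..M. \<Sum>S\<in>label_sets m. \<Sum>i=1..r m S. pal_loss (logits W h m S i) S)"
  proof (rule sum_mono)
    fix m
    assume m: "m \<in> {1..M}"
    \<comment> \<open>The subtraction in the bound on \<open>M\<close> is on naturals; since m is at
      least 1, it is not truncated here.\<close>
    then have "m < CARD('k)"
      using assms(2) by auto
    then show "real (num_samples r m) * c2 CARD('k) m (c1 m)
      - real (num_samples r m) * gamma1 CARD('k) m (c1 m) * A_const r m * sqrt (lamW / lamH) * (norm W)\<^sup>2
      \<le> (\<Sum>S\<in>label_sets m. \<Sum>i=1..r m S. pal_loss (logits W h m S i) S)"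
      using m assms bal by (intro sum_pal_loss_ge) auto
  qed
  \<comment> \<open>After scaling by 1/N, the \<open>c2\<close> terms add up to
    \<open>Gamma2\<close>.\<close>
  then have "1 / real (total_samples M r) * (\<Sum>m=1..M. real (num_samples r m) * c2 CARD('k) m (c1 m)
      - real (num_samples r m) * gamma1 CARD('k) m (c1 m) * A_const r m * sqrt (lamW / lamH) * (norm W)\<^sup>2)
    \<le> emp_risk M r (logits W h)"
    unfolding emp_risk_def by (rule mult_left_mono) simp
  then show ?thesis
    by (simp add: Gamma2_def sum_subtractf right_diff_distrib)
qed

end
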